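(* Let $\mathbf{X}=\{\mathbf{x}^1,\mathbf{x}^2,\mathbf{x}^3\}\subset\mathbb{R}^2$ with $\mathbf{x}^1,\mathbf{x}^2$ linearly independent and $\mathbf{x}^3=\mathbf{x}^1+\mathbf{x}^2=(1,0)^T$. Write $\mathbf{x}^1=(x^1_1,x^1_2)^T$ and assume $x^1_2>0$. Let $\mathbf{n}=(n_1,n_2,n_3)$ be a triple of positive integers. Then for $\mathbf{x}=(x_1,x_2)^T\in\mathbb{R}^2$ the cone spline $C_{\mathbf{n}}(\mathbf{x}\mid\mathbf{X})$ is given as follows. If $x_2\ge 0$, $$C_{\mathbf{n}}(\mathbf{x}\mid\mathbf{X})=\frac{1}{x^1_2}\sum_{k=0}^{n_1-1}\binom{n_2+k-1}{k}\frac{1}{(n_1-1-k)!\,(n_2+n_3+k-1)!}\left(\frac{x_2}{x^1_2}\right)^{n_1-1-k}\left(x_1-\frac{x^1_1}{x^1_2}x_2\right)_+^{n_2+n_3+k-1},$$ and if $x_2<0$, $$C_{\mathbf{n}}(\mathbf{x}\mid\mathbf{X})=\frac{1}{x^1_2}\sum_{k=0}^{n_2-1}\binom{n_1+k-1}{k}\frac{1}{(n_2-1-k)!\,(n_1+n_3+k-1)!}\left(-\frac{x_2}{x^1_2}\right)^{n_2-1-k}\left(x_1-\frac{x^1_1-1}{x^1_2}x_2\right)_+^{n_1+n_3+k-1}.$$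
   Context: Cone splines in $\mathbb{R}^2$. For linearly independent $\mathbf{x}^1,\mathbf{x}^2\in\mathbb{R}^2$ put $M=[\mathbf{x}^1\ \mathbf{x}^2]$ and $\mathrm{cone}(\{\mathbf{x}^1,\mathbf{x}^2\})=\{t_1\mathbf{x}^1+t_2\mathbf{x}^2 : t_1,t_2\ge 0\}$. The cone spline $C(\mathbf{x}\mid\{\mathbf{x}^1,\mathbf{x}^2\})$ equals $|\det(M)|^{-1}$ if $\mathbf{x}$ lies in this cone and $0$ otherwise. For an additional nonzero knot $\mathbf{y}$ (repetitions allowed, so knot sets are multisets) it is defined inductively by $C(\mathbf{x}\mid\mathbf{X}\cup\{\mathbf{y}\})=\int_0^\infty C(\mathbf{x}-t\mathbf{y}\mid\mathbf{X})\,dt$. For $\mathbf{n}=(n_1,n_2,n_3)$, $C_{\mathbf{n}}(\mathbf{x}\mid\mathbf{X})$ denotes the cone spline whose knot multiset consists of $\mathbf{x}^k$ repeated $n_k$ times, $k=1,2,3$. Notation: $x_+=\max(0,x)$, $x_+^m=(x_+)^m$ for $m\ge1$, and $0^0=1$. *)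

theory Defs
  imports "HOL-Analysis.Analysis" "HOL-Library.Multiset"
begin

definition cone2 :: "real^2 \<Rightarrow> real^2 \<Rightarrow> (real^2) set" where
  "cone2 a b = {t\<^sub>1 *\<^sub>R a + t\<^sub>2 *\<^sub>R b | t\<^sub>1 t\<^sub>2. t\<^sub>1 \<ge> 0 \<and> t\<^sub>2 \<ge> 0}"

(* vector [a, b] has a and b as rows, hence the transpose *)
definition knot_matrix :: "real^2 \<Rightarrow> real^2 \<Rightarrow> real^2^2" where
  "knot_matrix a b = transpose (vector [a, b])"

(* is_cone_spline X f: f is obtained from the knot multiset X by the inductive definition, for
   some choice of the initial pair and some order of the remaining knots. Stating the step with
   has_integral demands that all the integrals converge.
   The condition a \<noteq> b is needed because {a, b} collapses to a singleton when a = b. *)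
inductive is_cone_spline :: "(real^2) multiset \<Rightarrow> (real^2 \<Rightarrow> real) \<Rightarrow> bool" where
  base: "a \<noteq> b \<Longrightarrow> independent {a, b} \<Longrightarrow>
    is_cone_spline {#a, b#}
      (\<lambda>x. if x \<in> cone2 a b then inverse \<bar>det (knot_matrix a b)\<bar> else 0)"
| step: "is_cone_spline X f \<Longrightarrow> y \<noteq> 0 \<Longrightarrow>
    (\<And>x. ((\<lambda>t. f (x - t *\<^sub>R y)) has_integral g x) {0..}) \<Longrightarrow>
    is_cone_spline (add_mset y X) g"

(* The definite description is meaningful only where the result of the induction exists and does
   not depend on the order of the knots; an identity for cone_spline has to establish both. *)
definition cone_spline :: "(real^2) multiset \<Rightarrow> real^2 \<Rightarrow> real" where
  "cone_spline X = (THE f. is_cone_spline X f)"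

definition cone_spline_mult ::
  "nat \<Rightarrow> nat \<Rightarrow> nat \<Rightarrow> real^2 \<Rightarrow> real^2 \<Rightarrow> real^2 \<Rightarrow> real^2 \<Rightarrow> real" where
  "cone_spline_mult n1 n2 n3 x1 x2 x3 =
     cone_spline (replicate_mset n1 x1 + replicate_mset n2 x2 + replicate_mset n3 x3)"

end

theory Submission
  imports Defs
begin

text \<open>
  Write \<open>v\<close>, \<open>w\<close> for the two independent knots and \<open>x = s v + r w\<close>. In the coordinates \<open>(s, r)\<close>
  the three knots are \<open>(1, 0)\<close>, \<open>(0, 1)\<close>, \<open>(1, 1)\<close>, every pair of them has the same absolute
  determinant, and adding a knot means integrating along a ray in one of these three directions.
  The ray of the diagonal knot cuts the quadrant into two sectors that are exchanged by the symmetry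
  \<open>v \<leftrightarrow> w\<close>. On the sector \<open>s \<ge> r\<close>, with \<open>x = d v + u (v + w)\<close>, \<open>d = s - r\<close>, \<open>u = r\<close>, the
  candidate for the spline is the polynomial \<open>sector_poly\<close>, which is the formula to be proved.

  The candidate reproduces itself under the three integrations because \<open>sector_poly\<close> with one
  multiplicity raised is an antiderivative of \<open>sector_poly\<close> in the corresponding direction. For \<open>v\<close>
  and \<open>v + w\<close> only one factor in each term depends on the parameter of the ray; for \<open>w\<close> both do,
  and the sum telescopes by Pascal's rule (\<open>sector_poly_deriv_antidiagonal\<close>).
  Rays in direction \<open>v\<close> may cross the diagonal, where the polynomials of the two sectors
  match (\<open>sector_poly_diagonal\<close>).

  The cone spline is a definite description over all orders in which the knots can be added, and
  functions are compared at every point. The candidate is therefore defined for every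
  multiplicity triple with at most one zero, with values on the rays bounding the closed cones that
  agree with the base case. Then a single induction shows that whatever order is chosen, the result
  is the candidate (\<open>is_cone_spline_unique\<close>); adding knots to \<open>{v, w}\<close> one after the other shows
  that it exists (\<open>is_cone_spline_exists\<close>).
\<close>

section \<open>The candidate in knot coordinates\<close>

definition divpow :: "nat \<Rightarrow> real \<Rightarrow> real" where
  "divpow m u = u ^ m / fact m"

text \<open>
  The multiplicities of \<open>v\<close>, \<open>w\<close>, \<open>v + w\<close> are \<open>a\<close>, \<open>b\<close>, \<open>c\<close>. For \<open>b = 0\<close> truncated
  subtraction gives \<open>(0 + k - 1) choose k = 1\<close> at \<open>k = 0\<close> and \<open>0\<close> at all other \<open>k\<close>, so that only the term of the two-direction spline remains.
\<close>

definition sector_poly :: "nat \<Rightarrow> nat \<Rightarrow> nat \<Rightarrow> real \<Rightarrow> real \<Rightarrow> real" where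
  "sector_poly a b c d u =
     (\<Sum>k<a. real ((b + k - 1) choose k) * divpow (a - 1 - k) d * divpow (b + c + k - 1) u)"

text \<open>
  The cutoff by a condition, rather than by positive parts raised to powers, keeps exponent \<open>0\<close>
  correct: \<open>0 ^ 0 = 1\<close> would make a positive part to the power \<open>0\<close> equal to \<open>1\<close> outside the cone.
\<close>

definition sector :: "nat \<Rightarrow> nat \<Rightarrow> nat \<Rightarrow> real \<Rightarrow> real \<Rightarrow> real" where
  "sector a b c d u = (if 0 \<le> d \<and> 0 \<le> u then sector_poly a b c d u else 0)"

text \<open>
  The diagonal belongs to both closed sectors. If \<open>a\<close> and \<open>b\<close> are both positive the two values
  agree there; if \<open>a = 0\<close> the cone is the closed sector \<open>s \<le> r\<close>, and the formula of the
  other sector, an empty sum, would miss its boundary.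
\<close>

definition coord_spline :: "nat \<Rightarrow> nat \<Rightarrow> nat \<Rightarrow> real \<Rightarrow> real \<Rightarrow> real" where
  "coord_spline a b c s r =
     (if r < s \<or> r = s \<and> 0 < a then sector a b c (s - r) r else sector b a c (r - s) s)"

section \<open>Antiderivatives in the three knot directions\<close>

lemma divpow_0 [simp]: "divpow 0 u = 1"
  by (simp add: divpow_def)

lemma divpow_at_0: "0 < m \<Longrightarrow> divpow m 0 = 0"
  by (simp add: divpow_def)

lemma divpow_Suc_deriv:
  assumes "(f has_real_derivative f') (at x)"
  shows "((\<lambda>x. divpow (Suc m) (f x)) has_real_derivative divpow m (f x) * f') (at x)"
proof -
  have "((\<lambda>x. f x ^ Suc m / fact (Suc m)) has_real_derivative
      real (Suc m) * f x ^ m * f' / fact (Suc m)) (at x)"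
    using DERIV_cdivide[OF DERIV_power[OF assms, of "Suc m"], of "fact (Suc m)"]
    by (simp add: ac_simps del: power_Suc of_nat_Suc fact_Suc)
  then show ?thesis
    unfolding divpow_def by (rule DERIV_cong) (simp del: of_nat_Suc)
qed

lemma divpow_Suc_deriv_diff:
  "((\<lambda>t. divpow (Suc m) (u - t)) has_real_derivative - divpow m (u - t)) (at t)"
  by (rule divpow_Suc_deriv[THEN DERIV_cong]) (auto intro!: derivative_eq_intros)

lemma has_integral_half_line_FTC:
  fixes F h :: "real \<Rightarrow> real"
  assumes "p \<le> l" "l \<le> q"
    and deriv: "\<And>t. l \<le> t \<Longrightarrow> t \<le> q \<Longrightarrow> (F has_real_derivative h t) (at t)"
    and zero: "\<And>t. p \<le> t \<Longrightarrow> t < l \<or> q < t \<Longrightarrow> h t = 0"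
  shows "(h has_integral F q - F l) {p..}"
proof -
  have "(h has_integral F q - F l) {l..q}"
  proof (rule fundamental_theorem_of_calculus[OF assms(2)])
    fix t assume "t \<in> {l..q}"
    then have "(F has_real_derivative h t) (at t within {l..q})"
      using deriv[of t] has_field_derivative_at_within by simp
    then show "(F has_vector_derivative h t) (at t within {l..q})"
      by (simp only: has_real_derivative_iff_has_vector_derivative)
  qed
  then have "((\<lambda>t. if t \<in> {l..q} then h t else 0) has_integral F q - F l) {p..}"
    using assms(1) by (subst has_integral_restrict) auto
  then show ?thesis
  proof (rule has_integral_eq[rotated])
    fix t assume "t \<in> {p..}"
    then show "(if t \<in> {l..q} then h t else 0) = h t"
      using zero[of t] by auto
  qed
qed

text \<open>
  The hypothesis excludes terms in which the subtraction in \<open>b + c + k - 1\<close> truncates; it holds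
  whenever two of the three multiplicities are positive.
\<close>

lemma sector_poly_base_0:
  assumes "0 < b + c \<or> a = 0"
  shows "sector_poly a b (Suc c) d 0 = 0" "sector_poly a (Suc b) c d 0 = 0"
  using assms by (auto simp: sector_poly_def divpow_at_0 intro!: sum.neutral)

lemma sector_poly_deriv_u:
  assumes "0 < b + c \<or> a = 0"
  shows "((\<lambda>t. sector_poly a b (Suc c) d (u - t)) has_real_derivative
           - sector_poly a b c d (u - t)) (at t)"
proof (cases "a = 0")
  case True
  then show ?thesis by (simp add: sector_poly_def)
next
  case False
  with assms have *: "b + Suc c + k - 1 = Suc (b + c + k - 1)" for k by simp
  show ?thesis
    unfolding sector_poly_def * sum_negf[symmetric]
    by (rule DERIV_sum, rule DERIV_cong[OF DERIV_cmult[OF divpow_Suc_deriv_diff]]) simp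
qed

text \<open>
  Raising \<open>a\<close> raises the degree in \<open>d\<close> of each term and adds one term, which is constant in \<open>d\<close>.
\<close>

lemma sector_poly_deriv_d:
  "((\<lambda>t. sector_poly (Suc a) b c (d - t) u) has_real_derivative
      - sector_poly a b c (d - t) u) (at t)"
proof -
  have *: "Suc a - 1 - k = Suc (a - 1 - k)" if "k < a" for k using that by simp
  have "((\<lambda>t. \<Sum>k<a. real ((b + k - 1) choose k) * divpow (Suc (a - 1 - k)) (d - t)
            * divpow (b + c + k - 1) u) has_real_derivative
      - sector_poly a b c (d - t) u) (at t)"
    unfolding sector_poly_def sum_negf[symmetric]
    by (rule DERIV_sum, rule DERIV_cong[OF DERIV_cmult_right[OF DERIV_cmult[OF divpow_Suc_deriv_diff]]])
       simp
  then have "((\<lambda>t. (\<Sum>k<a. real ((b + k - 1) choose k) * divpow (Suc (a - 1 - k)) (d - t)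
            * divpow (b + c + k - 1) u) + real ((b + a - 1) choose a) * divpow (b + c + a - 1) u)
      has_real_derivative - sector_poly a b c (d - t) u) (at t)"
    by (rule DERIV_cong[OF DERIV_add[OF _ DERIV_const]]) simp
  also have "(\<lambda>t. (\<Sum>k<a. real ((b + k - 1) choose k) * divpow (Suc (a - 1 - k)) (d - t)
            * divpow (b + c + k - 1) u) + real ((b + a - 1) choose a) * divpow (b + c + a - 1) u)
        = (\<lambda>t. sector_poly (Suc a) b c (d - t) u)"
    unfolding sector_poly_def using * by simp
  finally show ?thesis .
qed

text \<open>
  Direction \<open>w\<close> leaves \<open>s = d + u\<close> fixed. The product rule turns each term into two, and
  the first part of term \<open>k - 1\<close> has the same powers as the second part of term \<open>k\<close>. Their
  coefficients combine to
  \<open>((b + k) choose k) - ((b + k - 1) choose (k - 1)) = ((b + k - 1) choose k)\<close>.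
\<close>

lemma sector_poly_deriv_antidiagonal:
  assumes "0 < b + c \<or> a = 0"
  shows "((\<lambda>t. sector_poly a (Suc b) c (d + t) (u - t)) has_real_derivative
           - sector_poly a b c (d + t) (u - t)) (at t)"
proof (cases a)
  case 0
  then show ?thesis by (simp add: sector_poly_def)
next
  case (Suc m)
  with assms have bc: "0 < b + c" by simp
  have idx: "Suc b + c + k - 1 = Suc (b + c + k - 1)" for k
    using bc by simp
  define D E where "D = (\<lambda>k. divpow k (d + t))" and "E = (\<lambda>k. divpow k (u - t))"
  define D' where "D' = (\<lambda>j. if j = 0 then 0 else D (j - 1))"
  have D: "((\<lambda>t. divpow j (d + t)) has_real_derivative D' j) (at t)" for j
  proof (cases j)
    case (Suc i)
    show ?thesis unfolding Suc D'_def D_def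
      by (rule divpow_Suc_deriv[THEN DERIV_cong]) (auto intro!: derivative_eq_intros)
  qed (simp add: D'_def)
  have E: "((\<lambda>t. divpow (Suc j) (u - t)) has_real_derivative - E j) (at t)" for j
    unfolding E_def by (rule divpow_Suc_deriv_diff)
  have "((\<lambda>t. sector_poly a (Suc b) c (d + t) (u - t)) has_real_derivative
      (\<Sum>k<a. real ((b + k) choose k) * (D' (m - k) * E (b + c + k)
                - D (m - k) * E (b + c + k - 1)))) (at t)"
    unfolding sector_poly_def idx
  proof (rule DERIV_sum)
    fix k assume "k \<in> {..<a}"
    have "((\<lambda>t. real ((b + k) choose k) * (divpow (m - k) (d + t) *
               divpow (Suc (b + c + k - 1)) (u - t))) has_real_derivative
          real ((b + k) choose k) * (D' (m - k) * E (b + c + k)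
                - D (m - k) * E (b + c + k - 1))) (at t)"
      using bc
      by (intro DERIV_cmult DERIV_cong[OF DERIV_mult[OF D E]])
         (auto simp: D_def E_def)
    then show "((\<lambda>t. real ((Suc b + k - 1) choose k) * divpow (a - 1 - k) (d + t) *
               divpow (Suc (b + c + k - 1)) (u - t)) has_real_derivative
          real ((b + k) choose k) * (D' (m - k) * E (b + c + k)
                - D (m - k) * E (b + c + k - 1))) (at t)"
      by (simp add: Suc mult.assoc)
  qed
  also have "(\<Sum>k<a. real ((b + k) choose k) * (D' (m - k) * E (b + c + k)
                - D (m - k) * E (b + c + k - 1))) =
        (\<Sum>k<a. real ((b + k) choose k) * (D' (m - k) * E (b + c + k)))
      - (\<Sum>k<a. real ((b + k) choose k) * (D (m - k) * E (b + c + k - 1)))"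
    by (simp add: right_diff_distrib sum_subtractf)
  also have "(\<Sum>k<a. real ((b + k) choose k) * (D' (m - k) * E (b + c + k))) =
      (\<Sum>k<m. real ((b + k) choose k) * (D (m - Suc k) * E (b + c + k)))"
    unfolding Suc by (auto simp: D'_def intro!: sum.cong)
  \<comment> \<open>Shift the index by one; the guard supplies the missing term at \<open>k = 0\<close>,
    where \<open>choose (k - 1)\<close> would be \<open>1\<close>.\<close>
  also have "\<dots> = (\<Sum>k<a. (if k = 0 then 0 else real ((b + k - 1) choose (k - 1)))
                      * (D (m - k) * E (b + c + k - 1)))"
    unfolding Suc sum.lessThan_Suc_shift by simp
  also have "\<dots> - (\<Sum>k<a. real ((b + k) choose k) * (D (m - k) * E (b + c + k - 1)))
      = - (\<Sum>k<a. real ((b + k - 1) choose k) * (D (m - k) * E (b + c + k - 1)))"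
    unfolding sum_negf[symmetric] sum_subtractf[symmetric]
  proof (rule sum.cong)
    fix k
    show "(if k = 0 then 0 else real ((b + k - 1) choose (k - 1))) * (D (m - k) * E (b + c + k - 1))
        - real ((b + k) choose k) * (D (m - k) * E (b + c + k - 1))
      = - (real ((b + k - 1) choose k) * (D (m - k) * E (b + c + k - 1)))"
      by (cases k) (simp_all add: algebra_simps)
  qed simp
  also have "\<dots> = - sector_poly a b c (d + t) (u - t)"
    by (simp add: sector_poly_def D_def E_def Suc mult.assoc)
  finally show ?thesis .
qed

text \<open>
  At \<open>d = 0\<close> only the term of degree \<open>0\<close> in \<open>d\<close> survives, and its coefficient is symmetric.
\<close>

lemma sector_poly_diagonal:
  assumes "0 < a + b"
  shows "sector_poly (Suc a) b c 0 u = sector_poly b (Suc a) c 0 u"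
proof -
  have diag: "sector_poly (Suc m) n c 0 u = real ((n + m - 1) choose m) * divpow (n + c + m - 1) u"
    for m n
    by (simp add: sector_poly_def divpow_at_0)
  show ?thesis
  proof (cases b)
    case 0
    then show ?thesis using assms unfolding diag by (simp add: sector_poly_def)
  next
    case (Suc n)
    then show ?thesis unfolding Suc diag
      using binomial_symmetric[of n "a + n"] by (simp add: ac_simps)
  qed
qed

section \<open>Integration along rays\<close>

lemma has_integral_sector_u:
  assumes "0 < b + c \<or> a = 0"
  shows "((\<lambda>t. sector a b c d (u - t)) has_integral sector a b (Suc c) d u) {0..}"
proof (cases "0 \<le> d \<and> 0 \<le> u")
  case True
  have "((\<lambda>t. sector a b c d (u - t)) has_integral
      - sector_poly a b (Suc c) d (u - u) - - sector_poly a b (Suc c) d (u - 0)) {0..}"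
  proof (rule has_integral_half_line_FTC[where F = "\<lambda>t. - sector_poly a b (Suc c) d (u - t)"])
    fix t assume "0 \<le> t" "t \<le> u"
    then have "sector a b c d (u - t) = - (- sector_poly a b c d (u - t))"
      using True by (simp add: sector_def)
    then show "((\<lambda>t. - sector_poly a b (Suc c) d (u - t)) has_real_derivative
        sector a b c d (u - t)) (at t)"
      by (simp only: DERIV_minus[OF sector_poly_deriv_u[OF assms]])
  qed (use True in \<open>auto simp: sector_def\<close>)
  then show ?thesis using True sector_poly_base_0(1)[OF assms] by (simp add: sector_def)
next
  case False
  then have "sector a b c d (u - t) = 0" if "0 \<le> t" for t
    using that by (auto simp: sector_def)
  then have "((\<lambda>t. sector a b c d (u - t)) has_integral 0) {0..}"
    by (intro has_integral_is_0) simp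
  moreover have "sector a b (Suc c) d u = 0"
    using False by (simp only: sector_def if_False)
  ultimately show ?thesis by (simp only:)
qed

text \<open>
  If the ray meets the sector, it does so in the parameter interval from \<open>p\<close> to \<open>u\<close>: it leaves through the wall
  where the second coordinate vanishes, and it either starts inside (\<open>p = 0\<close>) or enters through the
  diagonal wall (\<open>d + p = 0\<close>). The second case describes a ray that crosses over from the other sector.
\<close>

lemma has_integral_sector_antidiagonal:
  assumes bc: "0 < b + c \<or> a = 0" and "0 \<le> p" "0 \<le> d + p" and enter: "p = 0 \<or> d + p = 0"
  shows "((\<lambda>t. sector a b c (d + t) (u - t)) has_integral sector a (Suc b) c (d + p) (u - p)) {0..}"
proof -
  have before: "sector a b c (d + t) (u - t) = 0" if "0 \<le> t" "t < p" for t
  proof -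
    have "d + t < 0" using enter that by linarith
    then show ?thesis by (simp add: sector_def)
  qed
  have after: "sector a b c (d + t) (u - t) = 0" if "u < t" for t
    using that by (simp add: sector_def)
  show ?thesis
  proof (cases "p \<le> u")
    case True
    have "((\<lambda>t. sector a b c (d + t) (u - t)) has_integral
        - sector_poly a (Suc b) c (d + u) (u - u) - - sector_poly a (Suc b) c (d + p) (u - p)) {0..}"
    proof (rule has_integral_half_line_FTC[OF assms(2) True,
          where F = "\<lambda>t. - sector_poly a (Suc b) c (d + t) (u - t)"])
      fix t assume t: "p \<le> t" "t \<le> u"
      have "sector a b c (d + t) (u - t) = - (- sector_poly a b c (d + t) (u - t))"
        using t assms(3) by (simp add: sector_def)
      then show "((\<lambda>t. - sector_poly a (Suc b) c (d + t) (u - t)) has_real_derivative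
          sector a b c (d + t) (u - t)) (at t)"
        by (simp only: DERIV_minus[OF sector_poly_deriv_antidiagonal[OF bc]])
    qed (use before after in blast)
    then show ?thesis using True assms(3) sector_poly_base_0(2)[OF bc]
      by (simp add: sector_def)
  next
    case False
    have "sector a b c (d + t) (u - t) = 0" if "0 \<le> t" for t
      using before[OF that] after[of t] False by linarith
    then have "((\<lambda>t. sector a b c (d + t) (u - t)) has_integral 0) {0..}"
      by (intro has_integral_is_0) simp
    moreover have "sector a (Suc b) c (d + p) (u - p) = 0"
      using False by (simp add: sector_def)
    ultimately show ?thesis by (simp only:)
  qed
qed

text \<open>
  The ray leaves the sector through the diagonal, where the antiderivative need not vanish. The
  value subtracted is, for \<open>0 < a + b\<close>, what the rest of the ray contributes in the other sector.
\<close>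

lemma has_integral_sector_d:
  assumes "0 \<le> d"
  shows "((\<lambda>t. sector a b c (d - t) u) has_integral
           sector (Suc a) b c d u - sector (Suc a) b c 0 u) {0..}"
proof (cases "0 \<le> u")
  case True
  have "((\<lambda>t. sector a b c (d - t) u) has_integral
      - sector_poly (Suc a) b c (d - d) u - - sector_poly (Suc a) b c (d - 0) u) {0..}"
  proof (rule has_integral_half_line_FTC[where F = "\<lambda>t. - sector_poly (Suc a) b c (d - t) u"])
    fix t assume "0 \<le> t" "t \<le> d"
    then have "sector a b c (d - t) u = - (- sector_poly a b c (d - t) u)"
      using True by (simp add: sector_def)
    then show "((\<lambda>t. - sector_poly (Suc a) b c (d - t) u) has_real_derivative
        sector a b c (d - t) u) (at t)"
      by (simp only: DERIV_minus[OF sector_poly_deriv_d])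
  qed (use assms in \<open>auto simp: sector_def\<close>)
  then show ?thesis using True assms by (simp add: sector_def)
next
  case False
  then show ?thesis by (simp add: sector_def)
qed

lemma sector_diagonal:
  assumes "0 < a + b"
  shows "sector (Suc a) b c 0 u = sector b (Suc a) c 0 u"
  using sector_poly_diagonal[OF assms] by (simp add: sector_def)

section \<open>The candidate satisfies the recursion\<close>

lemma coord_spline_commute:
  assumes "0 < a + b"
  shows "coord_spline a b c s r = coord_spline b a c r s"
proof (cases "s = r \<and> 0 < a \<and> 0 < b")
  case True
  then obtain a' where "a = Suc a'" by (cases a) auto
  with True sector_diagonal[of a' b c r] show ?thesis
    by (simp add: coord_spline_def)
next
  case False
  with assms show ?thesis by (auto simp: coord_spline_def)
qed

text \<open>
  Along the diagonal direction \<open>s - r\<close> is constant, so the ray stays in one sector.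
\<close>

lemma has_integral_coord_spline_3:
  assumes "0 < a + c" "0 < b + c"
  shows "((\<lambda>t. coord_spline a b c (s - t) (r - t)) has_integral coord_spline a b (Suc c) s r) {0..}"
  using has_integral_sector_u[of b c a "s - r" r] has_integral_sector_u[of a c b "r - s" s] assms
  by (auto simp: coord_spline_def)

text \<open>
  A ray starting strictly on the side \<open>s < r\<close> stays there. A ray starting on the other side crosses
  the diagonal at parameter \<open>d\<close>, and the boundary terms of its two pieces cancel by
  \<open>sector_diagonal\<close>.
\<close>

lemma has_integral_coord_spline_1:
  assumes "0 < a + b" "0 < a + c"
  shows "((\<lambda>t. coord_spline a b c (s - t) r) has_integral coord_spline (Suc a) b c s r) {0..}"
proof (cases "s < r")
  case True
  have "0 < a + c \<or> b = 0" using assms(2) ..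
  then have "((\<lambda>t. sector b a c (r - s + t) (s - t)) has_integral sector b (Suc a) c (r - s) s) {0..}"
    using has_integral_sector_antidiagonal[of a c b 0 "r - s" s] True by simp
  then have "((\<lambda>t. coord_spline a b c (s - t) r) has_integral sector b (Suc a) c (r - s) s) {0..}"
    by (rule has_integral_eq[rotated]) (use True in \<open>auto simp: coord_spline_def algebra_simps\<close>)
  then show ?thesis using True by (simp add: coord_spline_def)
next
  case False
  define d where "d = s - r"
  have d: "0 \<le> d" using False by (simp add: d_def)
  have "((\<lambda>t. sector a b c (d - t) r) has_integral
      sector (Suc a) b c d r - sector (Suc a) b c 0 r) {0..}"
    by (rule has_integral_sector_d[OF d])
  moreover have "((\<lambda>t. sector b a c (- d + t) (s - t)) has_integral sector b (Suc a) c 0 r) {0..}"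
    using has_integral_sector_antidiagonal[of a c b d "- d" s, OF disjI1[OF assms(2)]] d
    by (simp add: d_def)
  ultimately have "((\<lambda>t. sector a b c (d - t) r + sector b a c (- d + t) (s - t)) has_integral
      sector (Suc a) b c d r - sector (Suc a) b c 0 r + sector b (Suc a) c 0 r) {0..}"
    by (rule has_integral_add)
  \<comment> \<open>Each summand vanishes on the piece of the other; only at the crossing \<open>t = d\<close> are both present.\<close>
  then have "((\<lambda>t. coord_spline a b c (s - t) r) has_integral
      sector (Suc a) b c d r - sector (Suc a) b c 0 r + sector b (Suc a) c 0 r) {0..}"
    by (rule has_integral_spike_finite[of "{d}", rotated 2])
       (auto simp: coord_spline_def sector_def d_def algebra_simps)
  then show ?thesis
    using False sector_diagonal[OF assms(1)] by (auto simp: coord_spline_def d_def)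
qed

lemma has_integral_coord_spline_2:
  assumes "0 < a + b" "0 < b + c"
  shows "((\<lambda>t. coord_spline a b c s (r - t)) has_integral coord_spline a (Suc b) c s r) {0..}"
  using has_integral_coord_spline_1[of b a c r s] assms
  by (simp add: coord_spline_commute[of a] ac_simps)

section \<open>From coordinates to the plane\<close>

definition cross :: "real^2 \<Rightarrow> real^2 \<Rightarrow> real" where
  "cross v w = v $ 1 * w $ 2 - v $ 2 * w $ 1"

lemma det_knot_matrix: "det (knot_matrix v w) = cross v w"
  by (simp add: knot_matrix_def transpose_def det_2 cross_def vector_2)

text \<open>
  The arguments of \<open>coord_spline\<close> are the coordinates of \<open>x\<close> in the basis \<open>v, w\<close> by Cramer's rule.
\<close>

definition mspline :: "real^2 \<Rightarrow> real^2 \<Rightarrow> (real^2) multiset \<Rightarrow> real^2 \<Rightarrow> real" where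
  "mspline v w X x = inverse \<bar>cross v w\<bar> *
     coord_spline (count X v) (count X w) (count X (v + w))
       (cross x w / cross v w) (cross v x / cross v w)"

lemma cross_expand:
  assumes "cross v w \<noteq> 0"
  shows "x = (cross x w / cross v w) *\<^sub>R v + (cross v x / cross v w) *\<^sub>R w"
  using assms unfolding vec_eq_iff forall_2
  by (auto simp: cross_def divide_simps) (algebra+)

lemma cross_cone2_iff:
  assumes "cross v w \<noteq> 0"
  shows "x \<in> cone2 v w \<longleftrightarrow> 0 \<le> cross x w / cross v w \<and> 0 \<le> cross v x / cross v w"
proof
  assume "x \<in> cone2 v w"
  then obtain p q where x: "x = p *\<^sub>R v + q *\<^sub>R w" and pq: "p \<ge> 0" "q \<ge> 0"
    by (auto simp: cone2_def)
  have "cross x w = p * cross v w" "cross v x = q * cross v w"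
    by (simp_all add: x cross_def algebra_simps)
  then show "0 \<le> cross x w / cross v w \<and> 0 \<le> cross v x / cross v w"
    using assms pq by simp
next
  assume "0 \<le> cross x w / cross v w \<and> 0 \<le> cross v x / cross v w"
  then show "x \<in> cone2 v w"
    using cross_expand[OF assms, of x] unfolding cone2_def by blast
qed

lemma cone2_commute: "cone2 v w = cone2 w v"
  by (auto simp: cone2_def) (metis add.commute)+

lemma knots_distinct:
  assumes "cross v w \<noteq> 0"
  shows "v \<noteq> w" "w \<noteq> v" "v + w \<noteq> v" "v \<noteq> v + w" "v + w \<noteq> w" "w \<noteq> v + w"
    "v \<noteq> 0" "w \<noteq> 0" "v + w \<noteq> 0"
proof -
  show "v \<noteq> w" "v \<noteq> 0" "w \<noteq> 0" using assms by (auto simp: cross_def)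
  then show "w \<noteq> v" "v + w \<noteq> v" "v \<noteq> v + w" "v + w \<noteq> w" "w \<noteq> v + w" by auto
  show "v + w \<noteq> 0"
  proof
    assume "v + w = 0"
    then have "w = - v" by (simp add: add_eq_0_iff)
    then show False using assms by (simp add: cross_def)
  qed
qed

text \<open>
  The base cones are the quadrant and its two closed sectors. The equality holds at every
  point, boundary rays included, and the value is the same for all three pairs because
  \<open>cross v (v + w) = cross (v + w) w = cross v w\<close>.
\<close>

lemma mspline_base:
  assumes vw: "cross v w \<noteq> 0" and "a \<noteq> b" "a \<in> {v, w, v + w}" "b \<in> {v, w, v + w}"
  shows "(if x \<in> cone2 a b then inverse \<bar>det (knot_matrix a b)\<bar> else 0) = mspline v w {#a, b#} x"
proof -
  define s r where "s = cross x w / cross v w" and "r = cross v x / cross v w"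
  have cr: "cross v (v + w) = cross v w" "cross (v + w) w = cross v w"
    by (simp_all add: cross_def algebra_simps)
  have "cross x (v + w) = cross x w - cross v x" "cross (v + w) x = cross v x - cross x w"
    by (simp_all add: cross_def algebra_simps)
  then have sr: "cross x (v + w) / cross v w = s - r" "cross (v + w) x / cross v w = r - s"
    by (simp_all add: s_def r_def diff_divide_distrib)
  have in1: "x \<in> cone2 v (v + w) \<longleftrightarrow> 0 \<le> s - r \<and> 0 \<le> r"
    using cross_cone2_iff[of v "v + w" x] vw by (simp add: cr sr r_def[symmetric])
  have in2: "x \<in> cone2 (v + w) w \<longleftrightarrow> 0 \<le> s \<and> 0 \<le> r - s"
    using cross_cone2_iff[of "v + w" w x] vw by (simp add: cr sr s_def[symmetric])
  have in3: "x \<in> cone2 v w \<longleftrightarrow> 0 \<le> s \<and> 0 \<le> r"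
    using cross_cone2_iff[of v w x] vw by (simp add: s_def r_def)
  note ne = knots_distinct[OF vw]
  have cs: "coord_spline 1 1 0 s r = (if 0 \<le> s \<and> 0 \<le> r then 1 else 0)"
    "coord_spline 1 0 1 s r = (if 0 \<le> s - r \<and> 0 \<le> r then 1 else 0)"
    "coord_spline 0 1 1 s r = (if 0 \<le> s \<and> 0 \<le> r - s then 1 else 0)"
    by (auto simp: coord_spline_def sector_def sector_poly_def)
  have ms: "mspline v w {#v, w#} x = inverse \<bar>cross v w\<bar> * coord_spline 1 1 0 s r"
    "mspline v w {#v, v + w#} x = inverse \<bar>cross v w\<bar> * coord_spline 1 0 1 s r"
    "mspline v w {#v + w, w#} x = inverse \<bar>cross v w\<bar> * coord_spline 0 1 1 s r"
    using ne by (simp_all add: mspline_def s_def r_def)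
  have eq: "(if x \<in> cone2 v w then inverse \<bar>det (knot_matrix v w)\<bar> else 0) = mspline v w {#v, w#} x"
    "(if x \<in> cone2 v (v + w) then inverse \<bar>det (knot_matrix v (v + w))\<bar> else 0)
      = mspline v w {#v, v + w#} x"
    "(if x \<in> cone2 (v + w) w then inverse \<bar>det (knot_matrix (v + w) w)\<bar> else 0)
      = mspline v w {#v + w, w#} x"
    unfolding ms cs det_knot_matrix cr in1 in2 in3 by simp_all
  have swap: "(if x \<in> cone2 q p then inverse \<bar>det (knot_matrix q p)\<bar> else 0) = mspline v w {#q, p#} x"
    if "(if x \<in> cone2 p q then inverse \<bar>det (knot_matrix p q)\<bar> else 0) = mspline v w {#p, q#} x"
    for p q
  proof -
    have "cross q p = - cross p q" by (simp add: cross_def)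
    then have "\<bar>det (knot_matrix q p)\<bar> = \<bar>det (knot_matrix p q)\<bar>"
      by (simp add: det_knot_matrix)
    then show ?thesis using that by (simp only: cone2_commute[of q p] add_mset_commute[of q p])
  qed
  have "a = v \<and> b = w \<or> a = v \<and> b = v + w \<or> a = v + w \<and> b = w \<or>
      a = w \<and> b = v \<or> a = v + w \<and> b = v \<or> a = w \<and> b = v + w"
    using assms(2-4) by blast
  then show ?thesis
    using eq eq[THEN swap] by (elim disjE conjE) (simp_all only:)
qed

lemma mspline_step:
  assumes vw: "cross v w \<noteq> 0" and y: "y \<in> {v, w, v + w}"
    and pos: "0 < count X v + count X w" "0 < count X v + count X (v + w)"
      "0 < count X w + count X (v + w)"
  shows "((\<lambda>t. mspline v w X (x - t *\<^sub>R y)) has_integral mspline v w (add_mset y X) x) {0..}"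
proof -
  note ne = knots_distinct[OF vw]
  have co: "cross (x - t *\<^sub>R v) w / cross v w = cross x w / cross v w - t"
    "cross v (x - t *\<^sub>R v) / cross v w = cross v x / cross v w"
    "cross (x - t *\<^sub>R w) w / cross v w = cross x w / cross v w"
    "cross v (x - t *\<^sub>R w) / cross v w = cross v x / cross v w - t"
    "cross (x - t *\<^sub>R (v + w)) w / cross v w = cross x w / cross v w - t"
    "cross v (x - t *\<^sub>R (v + w)) / cross v w = cross v x / cross v w - t" for t
  proof -
    have "cross (x - t *\<^sub>R v) w = cross x w - t * cross v w"
      "cross v (x - t *\<^sub>R v) = cross v x"
      "cross (x - t *\<^sub>R w) w = cross x w"
      "cross v (x - t *\<^sub>R w) = cross v x - t * cross v w"
      "cross (x - t *\<^sub>R (v + w)) w = cross x w - t * cross v w"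
      "cross v (x - t *\<^sub>R (v + w)) = cross v x - t * cross v w"
      by (simp_all add: cross_def algebra_simps)
    then show "cross (x - t *\<^sub>R v) w / cross v w = cross x w / cross v w - t"
      "cross v (x - t *\<^sub>R v) / cross v w = cross v x / cross v w"
      "cross (x - t *\<^sub>R w) w / cross v w = cross x w / cross v w"
      "cross v (x - t *\<^sub>R w) / cross v w = cross v x / cross v w - t"
      "cross (x - t *\<^sub>R (v + w)) w / cross v w = cross x w / cross v w - t"
      "cross v (x - t *\<^sub>R (v + w)) / cross v w = cross v x / cross v w - t"
      using vw by (simp_all add: diff_divide_distrib)
  qed
  consider "y = v" | "y = w" | "y = v + w" using y by auto
  then show ?thesis
  proof cases
    case 1
    show ?thesis unfolding mspline_def 1 co using ne
      by (auto intro!: has_integral_mult_right has_integral_coord_spline_1 pos)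
  next
    case 2
    show ?thesis unfolding mspline_def 2 co using ne
      by (auto intro!: has_integral_mult_right has_integral_coord_spline_2 pos)
  next
    case 3
    show ?thesis unfolding mspline_def 3 co using ne
      by (auto intro!: has_integral_mult_right has_integral_coord_spline_3 pos)
  qed
qed

section \<open>Independence of the order and existence\<close>

text \<open>
  The positivity of the pairwise sums says that at most one multiplicity is zero, which is what
  \<open>mspline_step\<close> needs; it is carried through the induction because every construction starts with
  two different knots.
\<close>

lemma is_cone_spline_unique:
  assumes "is_cone_spline X f" and vw: "cross v w \<noteq> 0" and "set_mset X \<subseteq> {v, w, v + w}"
  shows "f = mspline v w X \<and> 0 < count X v + count X w \<and>
    0 < count X v + count X (v + w) \<and> 0 < count X w + count X (v + w)"
  using assms(1,3)
proof induction
  case (base a b)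
  then have "(if x \<in> cone2 a b then inverse \<bar>det (knot_matrix a b)\<bar> else 0) = mspline v w {#a, b#} x"
    for x by (intro mspline_base vw) auto
  with base show ?case by auto
next
  case (step X f y g)
  have IH: "f = mspline v w X" "0 < count X v + count X w"
    "0 < count X v + count X (v + w)" "0 < count X w + count X (v + w)"
    using step by auto
  have "g x = mspline v w (add_mset y X) x" for x
    using step.hyps(3)[of x] mspline_step[OF vw _ IH(2-4), of y x] step.prems
    by (auto simp: IH(1) intro: has_integral_unique)
  with IH show ?case by auto
qed

lemma is_cone_spline_exists:
  assumes "independent {v, w}" and vw: "cross v w \<noteq> 0" and "set_mset Y \<subseteq> {v, w, v + w}"
  shows "is_cone_spline (Y + {#v, w#}) (mspline v w (Y + {#v, w#}))"
  using assms(3)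
proof (induction Y)
  case empty
  have "mspline v w {#v, w#} =
      (\<lambda>x. if x \<in> cone2 v w then inverse \<bar>det (knot_matrix v w)\<bar> else 0)"
    using mspline_base[OF vw, of v w] knots_distinct[OF vw] by auto
  then show ?case using is_cone_spline.base[of v w] knots_distinct[OF vw] assms(1) by simp
next
  case (add y Y)
  have "is_cone_spline (add_mset y (Y + {#v, w#})) (mspline v w (add_mset y (Y + {#v, w#})))"
    by (rule is_cone_spline.step[OF add.IH _ mspline_step[OF vw]])
       (use add.prems knots_distinct[OF vw] in auto)
  then show ?case by (simp only: union_mset_add_mset_left)
qed

lemma cone_spline_eq_mspline:
  assumes "independent {v, w}" and vw: "cross v w \<noteq> 0" and sub: "set_mset X \<subseteq> {v, w, v + w}"
    and "v \<in># X" "w \<in># X"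
  shows "cone_spline X = mspline v w X"
proof -
  define Y where "Y = X - {#v, w#}"
  have X: "X = Y + {#v, w#}"
  proof -
    have "{#v, w#} \<subseteq># X"
      using assms(4,5) knots_distinct(1)[OF vw] by (simp add: insert_subset_eq_iff in_diff_count)
    then show ?thesis by (simp only: Y_def subset_mset.diff_add)
  qed
  have "set_mset Y \<subseteq> {v, w, v + w}"
    using sub unfolding Y_def by (meson in_diffD subset_iff)
  from is_cone_spline_exists[OF assms(1) vw this] have ex: "is_cone_spline X (mspline v w X)"
    by (simp only: X[symmetric])
  have "f = mspline v w X" if "is_cone_spline X f" for f
    using is_cone_spline_unique[OF that vw sub] ..
  then show ?thesis unfolding cone_spline_def
    by (rule the_equality[where P = "is_cone_spline X", OF ex])
qed

section \<open>The closed form\<close>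

text \<open>
  For \<open>1 < b + c\<close> all exponents of the positive part are positive, so it vanishes for \<open>u < 0\<close> and
  replaces the cutoff.
\<close>

lemma sector_eq_max:
  assumes "0 \<le> d" "0 < a" "1 < b + c"
  shows "sector a b c d u = (\<Sum>k = 0..a - 1. real ((b + k - 1) choose k)
      * (1 / (fact (a - 1 - k) * fact (b + c + k - 1))) * d ^ (a - 1 - k)
      * (max 0 u) ^ (b + c + k - 1))"
proof -
  have idx: "{0..a - 1} = {..<a}" using assms(2) by auto
  show ?thesis
  proof (cases "0 \<le> u")
    case True
    then have "max 0 u = u" by simp
    then show ?thesis unfolding idx using True assms(1)
      by (simp add: sector_def sector_poly_def divpow_def)
  next
    case False
    then have "max 0 u = 0" by simp
    moreover have "(0::real) ^ (b + c + k - 1) = 0" for k using assms(3) by simp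
    ultimately show ?thesis using False by (simp only: sector_def) simp
  qed
qed

theorem proposition3p2:
  fixes x1 x2 x3 x :: "real^2" and n1 n2 n3 :: nat
  assumes "x1 \<noteq> x2" and "independent {x1, x2}"
    and "x3 = x1 + x2" and "x1 + x2 = vector [1, 0]"
    and "x1 $ 2 > 0"
    and "n1 > 0" and "n2 > 0" and "n3 > 0"
  shows "(x $ 2 \<ge> 0 \<longrightarrow>
      cone_spline_mult n1 n2 n3 x1 x2 x3 x =
        1 / x1 $ 2 * (\<Sum>k = 0..n1 - 1.
          real ((n2 + k - 1) choose k)
          * (1 / (fact (n1 - 1 - k) * fact (n2 + n3 + k - 1)))
          * (x $ 2 / x1 $ 2) ^ (n1 - 1 - k)
          * (max 0 (x $ 1 - x1 $ 1 / x1 $ 2 * x $ 2)) ^ (n2 + n3 + k - 1))) \<and>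
    (x $ 2 < 0 \<longrightarrow>
      cone_spline_mult n1 n2 n3 x1 x2 x3 x =
        1 / x1 $ 2 * (\<Sum>k = 0..n2 - 1.
          real ((n1 + k - 1) choose k)
          * (1 / (fact (n2 - 1 - k) * fact (n1 + n3 + k - 1)))
          * (- (x $ 2 / x1 $ 2)) ^ (n2 - 1 - k)
          * (max 0 (x $ 1 - (x1 $ 1 - 1) / x1 $ 2 * x $ 2)) ^ (n1 + n3 + k - 1)))"
proof -
  have x2: "x2 $ 1 = 1 - x1 $ 1" "x2 $ 2 = - x1 $ 2"
    using arg_cong[OF assms(4), of "\<lambda>v. v $ 1"] arg_cong[OF assms(4), of "\<lambda>v. v $ 2"]
    by simp_all
  have cr: "cross x1 x2 = - x1 $ 2"
    by (simp add: cross_def x2 algebra_simps)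
  then have ne: "cross x1 x2 \<noteq> 0" using assms(5) by simp
  note dist = knots_distinct[OF ne]
  define s r where "s = cross x x2 / cross x1 x2" and "r = cross x1 x / cross x1 x2"
  have r: "r = x $ 1 - x1 $ 1 / x1 $ 2 * x $ 2"
    and s: "s = x $ 1 - (x1 $ 1 - 1) / x1 $ 2 * x $ 2"
    using assms(5) unfolding r_def s_def cr by (simp_all add: cross_def x2 field_simps)
  \<comment> \<open>The two coordinates are the truncated linear forms of the claim, and the sign of \<open>x $ 2\<close>
    selects the sector.\<close>
  have sr: "s - r = x $ 2 / x1 $ 2"
    using assms(5) by (simp add: r s field_simps)
  let ?X = "replicate_mset n1 x1 + replicate_mset n2 x2 + replicate_mset n3 x3"
  have "set_mset ?X \<subseteq> {x1, x2, x1 + x2}" using assms(3) by (auto split: if_splits)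
  then have "cone_spline ?X = mspline x1 x2 ?X"
    using assms by (intro cone_spline_eq_mspline ne) auto
  then have main: "cone_spline_mult n1 n2 n3 x1 x2 x3 x = 1 / x1 $ 2 * coord_spline n1 n2 n3 s r"
    unfolding cone_spline_mult_def mspline_def s_def r_def
    using dist assms(3,5) by (simp add: cr inverse_eq_divide)
  show ?thesis
  proof (intro conjI impI)
    assume "x $ 2 \<ge> 0"
    then have d: "0 \<le> s - r" unfolding sr using assms(5) by simp
    then have "coord_spline n1 n2 n3 s r = sector n1 n2 n3 (s - r) r"
      using assms(6) by (auto simp: coord_spline_def)
    then show "cone_spline_mult n1 n2 n3 x1 x2 x3 x =
        1 / x1 $ 2 * (\<Sum>k = 0..n1 - 1.
          real ((n2 + k - 1) choose k)
          * (1 / (fact (n1 - 1 - k) * fact (n2 + n3 + k - 1)))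
          * (x $ 2 / x1 $ 2) ^ (n1 - 1 - k)
          * (max 0 (x $ 1 - x1 $ 1 / x1 $ 2 * x $ 2)) ^ (n2 + n3 + k - 1))"
      unfolding main r[symmetric] sr[symmetric]
      using sector_eq_max[OF d, of n1 n2 n3 r] assms(6-8) by simp
  next
    assume "x $ 2 < 0"
    then have "s - r < 0" unfolding sr using assms(5) by (simp add: divide_neg_pos)
    then have d: "0 \<le> r - s" and "coord_spline n1 n2 n3 s r = sector n2 n1 n3 (r - s) s"
      by (auto simp: coord_spline_def)
    moreover have rs: "r - s = - (x $ 2 / x1 $ 2)" using sr by linarith
    ultimately show "cone_spline_mult n1 n2 n3 x1 x2 x3 x =
        1 / x1 $ 2 * (\<Sum>k = 0..n2 - 1.
          real ((n1 + k - 1) choose k)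
          * (1 / (fact (n2 - 1 - k) * fact (n1 + n3 + k - 1)))
          * (- (x $ 2 / x1 $ 2)) ^ (n2 - 1 - k)
          * (max 0 (x $ 1 - (x1 $ 1 - 1) / x1 $ 2 * x $ 2)) ^ (n1 + n3 + k - 1))"
      unfolding main s[symmetric] rs[symmetric]
      using sector_eq_max[OF d, of n2 n1 n3 s] assms(6-8) by simp
  qed
qed

end
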